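(* Let $A=\{\mathbf a_1,\dots,\mathbf a_n\}\subset\mathbb Z^d$ be a finite set generating $\mathbb Z^d$ as a lattice, let $Q$ be the semigroup generated by $A$, and let $K=\mathrm{cone}(A)$, assumed pointed with non-empty interior. A face $F$ of $K$ is almost saturated if and only if every fundamental hole $\mathbf y$ of $Q$ can be written as $$\mathbf y=x_1\mathbf a_1+\dots+x_n\mathbf a_n,\quad x_j\in\mathbb Z\ \text{for all } j,\ \text{and } x_j\ge 0 \text{ for every } j \text{ with } \mathbf a_j\notin F.$$ Equivalently, $F$ is nowhere saturated if and only if this system has no feasible solution for some fundamental hole $\mathbf y$.
   Context: $Q=\{\sum_i\lambda_i\mathbf a_i:\lambda_i\in\mathbb N\}$, $K=\{\sum_i\lambda_i\mathbf a_i:\lambda_i\in\mathbb R_{\ge0}\}$, $Q_{\rm sat}=K\cap\mathbb Z^d$. A fundamental hole is a nonzero $\mathbf y\in Q_{\rm sat}$ with $Q_{\rm sat}\cap\{\mathbf y-\mathbf q:\mathbf q\in Q\}=\{\mathbf y\}$. A point $\mathbf a\in Q$ is a saturation point if $\mathbf a+Q_{\rm sat}\subset Q$. A face $F$ of $K$ is almost saturated if it contains a saturation point of $Q$, and nowhere saturated otherwise. *)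

theory Defs
  imports "HOL-Analysis.Analysis"
begin

text \<open>Everything lives in \<open>real ^ 'd\<close>, with \<open>d = CARD('d)\<close>. Coefficient families
  are indexed by the elements of the finite generating set \<open>A\<close> itself.\<close>

definition int_points :: "(real ^ 'd) set" where
  "int_points = {x. \<forall>i. x $ i \<in> \<int>}"

definition int_span :: "(real ^ 'd) set \<Rightarrow> (real ^ 'd) set" where
  "int_span A = {\<Sum>a\<in>A. real_of_int (c a) *\<^sub>R a | c. True}"

definition semigroup_of :: "(real ^ 'd) set \<Rightarrow> (real ^ 'd) set" where
  "semigroup_of A = {\<Sum>a\<in>A. real (c a) *\<^sub>R a | c. True}"

definition cone_of :: "(real ^ 'd) set \<Rightarrow> (real ^ 'd) set" where
  "cone_of A = {\<Sum>a\<in>A. c a *\<^sub>R a | c. \<forall>a\<in>A. 0 \<le> c a}"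

definition pointed :: "(real ^ 'd) set \<Rightarrow> bool" where
  "pointed K \<longleftrightarrow> K \<inter> uminus ` K = {0}"

definition saturation_of :: "(real ^ 'd) set \<Rightarrow> (real ^ 'd) set" where
  "saturation_of A = cone_of A \<inter> int_points"

definition fundamental_hole :: "(real ^ 'd) set \<Rightarrow> real ^ 'd \<Rightarrow> bool" where
  "fundamental_hole A y \<longleftrightarrow> y \<in> saturation_of A \<and> y \<noteq> 0 \<and>
     saturation_of A \<inter> {y - q | q. q \<in> semigroup_of A} = {y}"

definition saturation_point :: "(real ^ 'd) set \<Rightarrow> real ^ 'd \<Rightarrow> bool" where
  "saturation_point A p \<longleftrightarrow> p \<in> semigroup_of A \<and> (+) p ` saturation_of A \<subseteq> semigroup_of A"

definition almost_saturated :: "(real ^ 'd) set \<Rightarrow> (real ^ 'd) set \<Rightarrow> bool" where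
  "almost_saturated A F \<longleftrightarrow> (\<exists>p\<in>F. saturation_point A p)"

definition nowhere_saturated :: "(real ^ 'd) set \<Rightarrow> (real ^ 'd) set \<Rightarrow> bool" where
  "nowhere_saturated A F \<longleftrightarrow> \<not> almost_saturated A F"

text \<open>Faces of a cone are nonempty by convention, whereas \<^const>\<open>face_of\<close> also admits the
  empty set. (The zero face \<open>{0}\<close> of a pointed cone is a genuine face.)\<close>

definition cone_face :: "(real ^ 'd) set \<Rightarrow> (real ^ 'd) set \<Rightarrow> bool" where
  "cone_face F K \<longleftrightarrow> F face_of K \<and> F \<noteq> {}"

end

theory Submission
  imports Defs
begin

text \<open>If \<open>p \<in> F\<close> is a saturation point then \<open>p\<close> only uses generators in \<open>F\<close>, so subtracting it
  from \<open>p + y \<in> Q\<close> represents \<open>y\<close> as required. Conversely, splitting real coefficients into integer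
  and fractional parts gives \<open>Q\<^sub>s\<^sub>a\<^sub>t = P + Q\<close> with \<open>P\<close> finite, and pointedness lets one replace \<open>P\<close> by
  \<open>0\<close> and the fundamental holes in it. A representation of a hole \<open>y\<close> yields an element of \<open>Q \<inter> F\<close>
  that moves \<open>y\<close> into \<open>Q\<close>, and the sum of these finitely many elements is a saturation point.\<close>

section \<open>Closure properties of the semigroup and the cone\<close>

lemma semigroup_ofI: "(\<Sum>a\<in>A. real (c a) *\<^sub>R a) \<in> semigroup_of A"
  unfolding semigroup_of_def mem_Collect_eq by (rule exI[of _ c]) simp

lemma semigroup_of_0: "0 \<in> semigroup_of A"
  unfolding semigroup_of_def by (auto intro!: exI[of _ "\<lambda>_. 0"])

lemma semigroup_of_add:
  assumes "x \<in> semigroup_of A" "y \<in> semigroup_of A"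
  shows "x + y \<in> semigroup_of A"
proof -
  obtain c d where "x = (\<Sum>a\<in>A. real (c a) *\<^sub>R a)" "y = (\<Sum>a\<in>A. real (d a) *\<^sub>R a)"
    using assms unfolding semigroup_of_def by auto
  then have "x + y = (\<Sum>a\<in>A. real (c a + d a) *\<^sub>R a)"
    by (simp add: sum.distrib scaleR_left_distrib)
  then show ?thesis by (simp only: semigroup_ofI)
qed

lemma semigroup_of_sum:
  "(\<And>i. i \<in> I \<Longrightarrow> f i \<in> semigroup_of A) \<Longrightarrow> sum f I \<in> semigroup_of A"
  by (induction I rule: infinite_finite_induct) (auto intro: semigroup_of_0 semigroup_of_add)

lemma cone_of_0: "0 \<in> cone_of A"
  unfolding cone_of_def by (auto intro!: exI[of _ "\<lambda>_. 0"])

lemma cone_of_scaleR: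
  assumes "x \<in> cone_of A" "0 \<le> t"
  shows "t *\<^sub>R x \<in> cone_of A"
proof -
  obtain c where c: "x = (\<Sum>a\<in>A. c a *\<^sub>R a)" "\<forall>a\<in>A. 0 \<le> c a"
    using assms unfolding cone_of_def by auto
  then have "t *\<^sub>R x = (\<Sum>a\<in>A. (t * c a) *\<^sub>R a)"
    by (simp add: scaleR_right.sum)
  moreover have "\<forall>a\<in>A. 0 \<le> t * c a" using c assms by simp
  ultimately show ?thesis unfolding cone_of_def mem_Collect_eq by (intro exI conjI)
qed

lemma semigroup_of_subset_cone_of: "semigroup_of A \<subseteq> cone_of A"
  unfolding semigroup_of_def cone_of_def by fastforce

lemma semigroup_of_subset_int_points:
  assumes "A \<subseteq> int_points"
  shows "semigroup_of A \<subseteq> int_points"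
  using assms unfolding semigroup_of_def int_points_def
  by (fastforce simp: sum_component intro!: Ints_sum Ints_mult)

lemma pointed_add_eq_0:
  assumes "pointed K" "x \<in> K" "y \<in> K" "x + y = 0"
  shows "x = 0"
proof -
  have "x = - y" using assms(4) by (simp add: eq_neg_iff_add_eq_0)
  then show ?thesis using assms unfolding pointed_def by blast
qed

section \<open>Faces of the cone\<close>

lemma face_of_cone_of_scaleR:
  assumes F: "F face_of cone_of A" and x: "x \<in> F" and t: "0 \<le> t"
  shows "t *\<^sub>R x \<in> F"
proof (cases "x = 0")
  case True
  then show ?thesis using x by simp
next
  case False
  have xK: "x \<in> cone_of A" using F x face_of_imp_subset by blast
  \<comment> \<open>For \<open>s > 1\<close> and \<open>x\<close> nonzero, \<open>x\<close> is
    interior to the segment from \<open>0\<close> to \<open>s *\<^sub>R x\<close>, so the face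
    property captures both ends. The first end is the apex, the second gives all dilations.\<close>
  have end_points: "0 \<in> F \<and> s *\<^sub>R x \<in> F" if s: "1 < s" for s
  proof -
    have "x \<in> open_segment 0 (s *\<^sub>R x)"
      using s False by (auto simp: in_segment intro!: exI[of _ "1/s"])
    then show ?thesis
      using face_ofD[OF F _ cone_of_0 cone_of_scaleR[OF xK, of s] x] s by simp
  qed
  show ?thesis
  proof (cases "1 < t")
    case True
    then show ?thesis using end_points by blast
  next
    case False
    \<comment> \<open>Contractions come from convexity between the apex and \<open>x\<close>;
      \<open>end_points\<close> at the arbitrary value 2 supplies \<open>0 \<in> F\<close>.\<close>
    have "(1 - t) *\<^sub>R 0 + t *\<^sub>R x \<in> F"
      using False t x end_points[of 2] face_of_imp_convex[OF F] by (intro convexD) auto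
    then show ?thesis by simp
  qed
qed

lemma face_of_cone_of_0:
  assumes "F face_of cone_of A" "F \<noteq> {}"
  shows "0 \<in> F"
  using assms face_of_cone_of_scaleR[of F A _ 0] by auto

lemma face_of_cone_of_add:
  assumes "F face_of cone_of A" "x \<in> F" "y \<in> F"
  shows "x + y \<in> F"
proof -
  have "(1/2) *\<^sub>R x + (1/2) *\<^sub>R y \<in> F"
    using assms face_of_imp_convex by (intro convexD) auto
  from face_of_cone_of_scaleR[OF assms(1) this, of 2] show ?thesis
    by (simp add: scaleR_right_distrib)
qed

lemma face_of_cone_of_sum:
  assumes "F face_of cone_of A" "F \<noteq> {}" "\<And>i. i \<in> I \<Longrightarrow> f i \<in> F"
  shows "sum f I \<in> F"
  using assms(3)
  by (induction I rule: infinite_finite_induct)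
    (auto intro: face_of_cone_of_0[OF assms(1,2)] face_of_cone_of_add[OF assms(1)])

text \<open>The point \<open>x + y\<close> is the midpoint of \<open>2 *\<^sub>R x\<close> and
  \<open>2 *\<^sub>R y\<close>, both in the cone, so the face property applies to this segment. The
  case \<open>x = y\<close> is separate because the open segment is then empty.\<close>

lemma face_of_cone_of_summand:
  assumes F: "F face_of cone_of A" and x: "x \<in> cone_of A" and y: "y \<in> cone_of A"
    and xy: "x + y \<in> F"
  shows "x \<in> F"
proof -
  have "2 *\<^sub>R x \<in> F"
  proof (cases "x = y")
    case True
    then show ?thesis using xy by (simp add: scaleR_2)
  next
    case False
    have "x + y \<in> open_segment (2 *\<^sub>R x) (2 *\<^sub>R y)"
      using False by (auto simp: in_segment intro!: exI[of _ "1/2"])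
    then show ?thesis
      using F xy cone_of_scaleR[OF x, of 2] cone_of_scaleR[OF y, of 2]
      unfolding face_of_def by auto
  qed
  from face_of_cone_of_scaleR[OF F this, of "1/2"] show ?thesis by simp
qed

text \<open>The term of \<open>b\<close> and the sum of the remaining terms both lie in the cone, so
  the first is in \<open>F\<close> as a summand; dividing by its positive coefficient leaves
  \<open>b\<close>.\<close>

lemma face_of_cone_of_generator:
  assumes "finite A" and F: "F face_of cone_of A" and c: "\<forall>a\<in>A. 0 \<le> c a"
    and sum: "(\<Sum>a\<in>A. c a *\<^sub>R a) \<in> F" and b: "b \<in> A" "0 < c b"
  shows "b \<in> F"
proof -
  \<comment> \<open>Zero coefficients pad both pieces to sums over all of \<open>A\<close>, the
    shape that \<open>cone_of\<close> demands.\<close>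
  have "(\<Sum>a\<in>A. (if a = b then c a else 0) *\<^sub>R a) \<in> cone_of A"
    using c unfolding cone_of_def by fastforce
  then have 1: "c b *\<^sub>R b \<in> cone_of A"
    using assms(1) b by (simp add: if_distrib[of "\<lambda>t. t *\<^sub>R _"] sum.delta cong: if_cong)
  have "(\<Sum>a\<in>A. (if a = b then 0 else c a) *\<^sub>R a) \<in> cone_of A"
    using c unfolding cone_of_def by fastforce
  moreover have "(\<Sum>a\<in>A. (if a = b then 0 else c a) *\<^sub>R a) = (\<Sum>a\<in>A - {b}. c a *\<^sub>R a)"
    using assms(1) by (intro sum.mono_neutral_cong_right) auto
  ultimately have 2: "(\<Sum>a\<in>A - {b}. c a *\<^sub>R a) \<in> cone_of A" by simp
  have "c b *\<^sub>R b + (\<Sum>a\<in>A - {b}. c a *\<^sub>R a) \<in> F"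
    using sum b assms(1) by (simp add: sum.remove)
  then have "c b *\<^sub>R b \<in> F" by (rule face_of_cone_of_summand[OF F 1 2])
  from face_of_cone_of_scaleR[OF F this, of "1 / c b"] show ?thesis using b by simp
qed

section \<open>Lattice points, remainders and fundamental holes\<close>

lemma finite_bounded_int_points:
  fixes S :: "(real ^ 'd) set"
  assumes "bounded S"
  shows "finite (S \<inter> int_points)"
proof -
  obtain B where B: "\<And>x. x \<in> S \<Longrightarrow> norm x \<le> B" using assms bounded_iff by blast
  \<comment> \<open>Coordinates are bounded by the norm, so a lattice point of \<open>S\<close> is a
    function from the finite index type into this finite set of integers.\<close>
  let ?I = "{z \<in> \<int>. \<bar>z\<bar> \<le> B}"
  have "finite ?I" by (rule finite_abs_int_segment)
  then have "finite (PiE (UNIV :: 'd set) (\<lambda>_. ?I))" by (intro finite_PiE) auto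
  moreover have "vec_nth ` (S \<inter> int_points) \<subseteq> PiE UNIV (\<lambda>_. ?I)"
    using B by (auto simp: int_points_def PiE_def intro: order_trans[OF component_le_norm_cart])
  ultimately have "finite (vec_nth ` (S \<inter> int_points))" by (rule rev_finite_subset)
  then show ?thesis by (rule finite_imageD) (auto intro: inj_onI simp: vec_nth_inject)
qed

text \<open>Rounding the coefficients of \<open>s\<close> down splits off an element of the
  semigroup. What remains is a lattice point of the cone with coefficients in [0,1), hence in a
  bounded region.\<close>

lemma saturation_of_finite_remainders:
  fixes A :: "(real ^ 'd) set"
  assumes "finite A" "A \<subseteq> int_points"
  obtains P where "finite P" "P \<subseteq> saturation_of A"
    and "\<And>s. s \<in> saturation_of A \<Longrightarrow> \<exists>p\<in>P. s - p \<in> semigroup_of A"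
proof
  \<comment> \<open>By the triangle inequality this radius bounds every combination with
    coefficients in [0,1).\<close>
  let ?B = "cball 0 (\<Sum>a\<in>A. norm a) :: (real ^ 'd) set"
  let ?P = "?B \<inter> int_points \<inter> cone_of A"
  show "finite ?P" using finite_bounded_int_points[of ?B] by blast
  show "?P \<subseteq> saturation_of A" unfolding saturation_of_def by blast
  fix s assume s: "s \<in> saturation_of A"
  then obtain c where c: "s = (\<Sum>a\<in>A. c a *\<^sub>R a)" "\<forall>a\<in>A. 0 \<le> c a"
    unfolding saturation_of_def cone_of_def by auto
  define q where "q = (\<Sum>a\<in>A. real (nat \<lfloor>c a\<rfloor>) *\<^sub>R a)"
  have q: "q \<in> semigroup_of A" unfolding q_def by (rule semigroup_ofI)
  \<comment> \<open>Nonnegativity of \<open>c a\<close> ensures that \<open>nat\<close> does not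
    truncate the floor.\<close>
  have floor: "real (nat \<lfloor>c a\<rfloor>) = c a - frac (c a)" if "a \<in> A" for a
    using that c by (simp add: frac_def)
  have "q = (\<Sum>a\<in>A. (c a - frac (c a)) *\<^sub>R a)"
    unfolding q_def by (rule sum.cong) (auto simp: floor)
  then have r: "s - q = (\<Sum>a\<in>A. frac (c a) *\<^sub>R a)"
    unfolding c(1) by (simp add: sum_subtractf scaleR_left_diff_distrib)
  have "norm (s - q) \<le> (\<Sum>a\<in>A. norm a)"
    unfolding r by (rule sum_norm_le)
      (simp add: mult_left_le_one_le frac_lt_1 less_imp_le)
  moreover have "s - q \<in> cone_of A"
    unfolding r cone_of_def by (auto intro!: exI[of _ "\<lambda>a. frac (c a)"])
  moreover have "s - q \<in> int_points"
    using s q semigroup_of_subset_int_points[OF assms(2)]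
    unfolding saturation_of_def int_points_def by auto
  ultimately show "\<exists>p\<in>?P. s - p \<in> semigroup_of A"
    using q by (intro bexI[of _ "s - q"]) auto
qed

text \<open>By pointedness, \<open>s - t \<in> Q\<close> is a partial order on the saturation; minimal elements of the
  finite set of remainders are minimal in the whole saturation.\<close>

lemma saturation_of_finite_holes:
  fixes A :: "(real ^ 'd) set"
  assumes "finite A" "A \<subseteq> int_points" "pointed (cone_of A)"
  obtains H where "finite H" "\<And>y. y \<in> H \<Longrightarrow> fundamental_hole A y"
    and "\<And>s. s \<in> saturation_of A \<Longrightarrow> \<exists>y\<in>insert 0 H. s - y \<in> semigroup_of A"
proof -
  obtain P where P: "finite P" "P \<subseteq> saturation_of A"
    and cover: "\<And>s. s \<in> saturation_of A \<Longrightarrow> \<exists>p\<in>P. s - p \<in> semigroup_of A"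
    using saturation_of_finite_remainders[OF assms(1,2)] by metis
  have antisym: "q = 0" if "q \<in> semigroup_of A" "q' \<in> semigroup_of A" "q + q' = 0" for q q'
    using pointed_add_eq_0[OF assms(3)] that semigroup_of_subset_cone_of by blast
  define less where "less u v \<longleftrightarrow> v - u \<in> semigroup_of A \<and> u \<noteq> v" for u v
  have transp: "transp less"
  proof (rule transpI)
    fix u v w assume "less u v" "less v w"
    then have *: "v - u \<in> semigroup_of A" "w - v \<in> semigroup_of A" "u \<noteq> v"
      by (auto simp: less_def)
    have "u \<noteq> w" using antisym[OF *(1,2)] *(3) by auto
    then show "less u w" using semigroup_of_add[OF *(1,2)] by (simp add: less_def)
  qed
  have asymp: "asymp less"
  proof (rule asympI)
    fix u v assume "less u v"
    then show "\<not> less v u" using antisym[of "v - u" "u - v"] by (auto simp: less_def)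
  qed
  show ?thesis
  proof
    show "finite {y \<in> P. fundamental_hole A y}" using P(1) by simp
    show "fundamental_hole A y" if "y \<in> {y \<in> P. fundamental_hole A y}" for y
      using that by simp
    fix s assume s: "s \<in> saturation_of A"
    let ?M = "{p \<in> P. s - p \<in> semigroup_of A}"
    have "finite ?M" "?M \<noteq> {}" using P(1) cover[OF s] by auto
    \<comment> \<open>Among the remainders that can be subtracted from \<open>s\<close> within the
      semigroup, \<open>t\<close> is a minimal one.\<close>
    then obtain t where t: "t \<in> ?M" and t_min: "\<And>u. u \<in> ?M \<Longrightarrow> \<not> less u t"
      using Finite_Set.bex_min_element[of ?M less] asymp_on_subset[OF asymp, of ?M]
        transp_on_subset[OF transp, of ?M] by (auto simp: less_def)
    \<comment> \<open>A remainder \<open>u\<close> of \<open>t - q\<close> satisfies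
      \<open>t - u = q + (t - q - u)\<close>, so it also lies in \<open>?M\<close> and is not above
      \<open>t\<close>. Minimality forces \<open>u = t\<close>; then \<open>q\<close> and
      \<open>t - q - u\<close> sum to zero, and pointedness gives \<open>q = 0\<close>.\<close>
    have minimal: "q = 0" if q: "q \<in> semigroup_of A" "t - q \<in> saturation_of A" for q
    proof -
      obtain u where u: "u \<in> P" "t - q - u \<in> semigroup_of A" using cover[OF q(2)] by blast
      have tu: "t - u \<in> semigroup_of A" using semigroup_of_add[OF q(1) u(2)] by simp
      then have "s - u \<in> semigroup_of A" using semigroup_of_add[of "s - t" A "t - u"] t by simp
      then have "u = t" using t_min[of u] u(1) tu by (auto simp: less_def)
      then show ?thesis using antisym[OF q(1) u(2)] by simp
    qed
    have tsat: "t \<in> saturation_of A" using t P(2) by auto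
    have "fundamental_hole A t" if "t \<noteq> 0"
    proof -
      have "saturation_of A \<inter> {t - q | q. q \<in> semigroup_of A} = {t}"
        using tsat minimal by (auto intro!: exI[of _ 0] simp: semigroup_of_0)
      then show ?thesis using tsat that unfolding fundamental_hole_def by blast
    qed
    \<comment> \<open>Fundamental holes are nonzero by definition, so \<open>t = 0\<close> is
      covered by the inserted \<open>0\<close>.\<close>
    then show "\<exists>y\<in>insert 0 {y \<in> P. fundamental_hole A y}. s - y \<in> semigroup_of A"
      using t by (cases "t = 0") auto
  qed
qed

section \<open>Saturation points and representations of holes\<close>

lemma saturation_point_imp_representation:
  fixes A F :: "(real ^ 'd) set"
  assumes "finite A" and F: "F face_of cone_of A" and p: "p \<in> F" "saturation_point A p"
    and y: "y \<in> saturation_of A"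
  shows "\<exists>x :: real ^ 'd \<Rightarrow> int. y = (\<Sum>a\<in>A. real_of_int (x a) *\<^sub>R a) \<and>
           (\<forall>a\<in>A. a \<notin> F \<longrightarrow> 0 \<le> x a)"
proof -
  have "p \<in> semigroup_of A" "p + y \<in> semigroup_of A"
    using p(2) y unfolding saturation_point_def by auto
  then obtain m n where m: "p = (\<Sum>a\<in>A. real (m a) *\<^sub>R a)"
    and n: "p + y = (\<Sum>a\<in>A. real (n a) *\<^sub>R a)"
    unfolding semigroup_of_def by auto
  \<comment> \<open>A generator occurring in \<open>p\<close> with positive coefficient would lie in
    \<open>F\<close>. Hence \<open>n a - m a\<close> equals \<open>n a\<close> off \<open>F\<close>
    and is nonnegative there.\<close>
  have "m a = 0" if "a \<in> A" "a \<notin> F" for a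
    using face_of_cone_of_generator[OF assms(1) F, of "\<lambda>a. real (m a)" a] p(1) m that by auto
  moreover have "y = (\<Sum>a\<in>A. real_of_int (int (n a) - int (m a)) *\<^sub>R a)"
    using m n by (simp add: sum_subtractf scaleR_left_diff_distrib eq_diff_eq add.commute)
  ultimately show ?thesis by (intro exI[of _ "\<lambda>a. int (n a) - int (m a)"]) simp
qed

text \<open>The shift is the negative part of the representation: it involves only generators in
  \<open>F\<close>, and adding it to \<open>y\<close> leaves the positive part.\<close>

lemma representation_imp_shift:
  fixes A F :: "(real ^ 'd) set"
  assumes F: "F face_of cone_of A" "F \<noteq> {}"
    and y: "y = (\<Sum>a\<in>A. real_of_int (x a) *\<^sub>R a)" and x: "\<forall>a\<in>A. a \<notin> F \<longrightarrow> 0 \<le> x a"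
  shows "\<exists>p \<in> F \<inter> semigroup_of A. p + y \<in> semigroup_of A"
proof
  define p where "p = (\<Sum>a\<in>A. real (nat (- x a)) *\<^sub>R a)"
  have "real (nat (- x a)) *\<^sub>R a \<in> F" if "a \<in> A" for a
    using that x face_of_cone_of_scaleR[OF F(1), of a] face_of_cone_of_0[OF F] by (cases "a \<in> F") auto
  then have "p \<in> F" unfolding p_def by (rule face_of_cone_of_sum[OF F])
  then show "p \<in> F \<inter> semigroup_of A" by (simp add: p_def semigroup_ofI)
  have "p + y = (\<Sum>a\<in>A. (real (nat (- x a)) + real_of_int (x a)) *\<^sub>R a)"
    unfolding p_def y by (simp add: sum.distrib scaleR_left_distrib)
  \<comment> \<open>Coefficientwise this is max(-k, 0) + k = max(k, 0) for an integer k.\<close>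
  also have "\<dots> = (\<Sum>a\<in>A. real (nat (x a)) *\<^sub>R a)"
    by (intro sum.cong refl arg_cong2[of _ _ _ _ scaleR]) linarith
  finally show "p + y \<in> semigroup_of A" using semigroup_ofI by simp
qed

lemma almost_saturated_iff:
  fixes A F :: "(real ^ 'd) set"
  assumes "finite A" "A \<subseteq> int_points" "pointed (cone_of A)" "cone_face F (cone_of A)"
  shows "almost_saturated A F \<longleftrightarrow>
           (\<forall>y. fundamental_hole A y \<longrightarrow>
             (\<exists>x :: real ^ 'd \<Rightarrow> int. y = (\<Sum>a\<in>A. real_of_int (x a) *\<^sub>R a) \<and>
                (\<forall>a\<in>A. a \<notin> F \<longrightarrow> 0 \<le> x a)))"
    (is "?L \<longleftrightarrow> ?R")
proof
  have F: "F face_of cone_of A" "F \<noteq> {}" using assms(4) by (auto simp: cone_face_def)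
  {
    assume ?L
    then obtain p where "p \<in> F" "saturation_point A p" unfolding almost_saturated_def by blast
    then show ?R
      using saturation_point_imp_representation[OF assms(1) F(1)]
      unfolding fundamental_hole_def by blast
  next
    assume R: ?R
    obtain H where H: "finite H" "\<And>y. y \<in> H \<Longrightarrow> fundamental_hole A y"
      and cover: "\<And>s. s \<in> saturation_of A \<Longrightarrow> \<exists>y\<in>insert 0 H. s - y \<in> semigroup_of A"
      using saturation_of_finite_holes[OF assms(1-3)] by metis
    have "\<forall>y\<in>H. \<exists>p. p \<in> F \<and> p \<in> semigroup_of A \<and> p + y \<in> semigroup_of A"
      using R H(2) representation_imp_shift[OF F] by blast
    then obtain f where f: "\<And>y. y \<in> H \<Longrightarrow> f y \<in> F" "\<And>y. y \<in> H \<Longrightarrow> f y \<in> semigroup_of A"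
      "\<And>y. y \<in> H \<Longrightarrow> f y + y \<in> semigroup_of A" by metis
    have sum_Q: "sum f H \<in> semigroup_of A" using f(2) by (rule semigroup_of_sum)
    have "sum f H + s \<in> semigroup_of A" if s: "s \<in> saturation_of A" for s
    proof -
      obtain y where y: "y \<in> insert 0 H" "s - y \<in> semigroup_of A" using cover[OF s] by blast
      \<comment> \<open>For a hole \<open>y\<close>, the single summand \<open>f y\<close> absorbs
        \<open>y\<close>, and the other summands stay in the semigroup; thus one point serves all of
        \<open>H\<close>.\<close>
      have "sum f H + y \<in> semigroup_of A"
      proof (cases "y \<in> H")
        case True
        have "sum f (H - {y}) \<in> semigroup_of A" using f(2) by (intro semigroup_of_sum) auto
        from semigroup_of_add[OF this f(3)[OF True]] show ?thesis
          using H(1) True by (simp add: sum.remove[of H y] algebra_simps)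
      next
        case False
        then show ?thesis using y(1) sum_Q by simp
      qed
      from semigroup_of_add[OF this y(2)] show ?thesis by simp
    qed
    then have "saturation_point A (sum f H)" using sum_Q unfolding saturation_point_def by auto
    moreover have "sum f H \<in> F" using f(1) by (rule face_of_cone_of_sum[OF F])
    ultimately show ?L unfolding almost_saturated_def by blast
  }
qed

theorem theorem3p3:
  fixes A F :: "(real ^ 'd) set"
  assumes "finite A"
    and "A \<subseteq> int_points"
    and "int_span A = int_points"
    and "pointed (cone_of A)"
    and "interior (cone_of A) \<noteq> {}"
    and "cone_face F (cone_of A)"
  shows "(almost_saturated A F \<longleftrightarrow>
            (\<forall>y. fundamental_hole A y \<longrightarrow>
              (\<exists>x :: real ^ 'd \<Rightarrow> int. y = (\<Sum>a\<in>A. real_of_int (x a) *\<^sub>R a) \<and>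
                 (\<forall>a\<in>A. a \<notin> F \<longrightarrow> 0 \<le> x a)))) \<and>
         (nowhere_saturated A F \<longleftrightarrow>
            (\<exists>y. fundamental_hole A y \<and>
              \<not> (\<exists>x :: real ^ 'd \<Rightarrow> int. y = (\<Sum>a\<in>A. real_of_int (x a) *\<^sub>R a) \<and>
                 (\<forall>a\<in>A. a \<notin> F \<longrightarrow> 0 \<le> x a))))"
  using almost_saturated_iff[OF assms(1,2,4,6)] unfolding nowhere_saturated_def by blast

end
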